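(* For each integer $\Delta \geq 4$, there exists a primitive Markov move for $B_\Delta$ of degree $2\left(\left\lfloor \frac{\Delta}{2} \right\rfloor - 1\right)^2 + 1$.
   Context: For a positive integer $\Delta$, $B_\Delta$ is the $(3\Delta-1)\times\binom{\Delta+1}{2}$ integer matrix whose columns are indexed by pairs $ij$ with $1\le i\le j\le\Delta$ (in lexicographic order) and whose entries are as follows. For a row $a$ with $1\le a\le\Delta$, $B_\Delta(a,ij)=2$ if $i=j=a$, $=1$ if exactly one of $i,j$ equals $a$, and $=0$ otherwise. For $2\le\kappa\le2\Delta$, the row $\kappa+\Delta-1$ has $B_\Delta(\kappa+\Delta-1,ij)=1$ if $i+j=\kappa$ and $0$ otherwise. For an integer vector $\mathbf{u}$, $\mathbf{u}^+$ and $\mathbf{u}^-$ denote the nonnegative vectors with disjoint support, $(\mathbf{u}^+)_p=\max\{u_p,0\}$ and $\mathbf{u}^-=\mathbf{u}^+-\mathbf{u}$, so $\mathbf{u}=\mathbf{u}^+-\mathbf{u}^-$. For an integer matrix $A$, $\ker_{\mathbb{Z}}(A)$ is the set of integer vectors $\mathbf{u}$ with $A\mathbf{u}=\mathbf{0}$. A (Markov) move for $A$ is an element of $\ker_{\mathbb{Z}}(A)$. A nonzero move $\mathbf{u}$ is primitive for $A$ if there is no nonzero $\mathbf{v}\in\ker_{\mathbb{Z}}(A)$ with $\mathbf{v}\neq\mathbf{u}$, $\mathbf{u}^+-\mathbf{v}^+\ge\mathbf{0}$ and $\mathbf{u}^--\mathbf{v}^-\ge\mathbf{0}$ (entrywise).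 The degree of a move $\mathbf{u}$ for $B_\Delta$ is the sum of the entries of $\mathbf{u}^+$ (equivalently, of $\mathbf{u}^-$; these agree since the all-ones vector lies in the row span of $B_\Delta$). *)

theory Defs
  imports Complex_Main "Jordan_Normal_Form.Matrix_Kernel"
begin

definition pos_part :: "int vec \<Rightarrow> int vec" where
  "pos_part u = map_vec (\<lambda>x. max x 0) u"

definition neg_part :: "int vec \<Rightarrow> int vec" where
  "neg_part u = pos_part u - u"

abbreviation markov_move :: "int mat \<Rightarrow> int vec \<Rightarrow> bool" where
  "markov_move A u \<equiv> u \<in> mat_kernel A"

definition primitive_move :: "int mat \<Rightarrow> int vec \<Rightarrow> bool" where
  "primitive_move A u \<longleftrightarrow>
     markov_move A u \<and> u \<noteq> 0\<^sub>v (dim_col A) \<and>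
     \<not> (\<exists>v. v \<in> mat_kernel A \<and> v \<noteq> 0\<^sub>v (dim_col A) \<and> v \<noteq> u \<and>
           pos_part u - pos_part v \<ge> 0\<^sub>v (dim_col A) \<and>
           neg_part u - neg_part v \<ge> 0\<^sub>v (dim_col A))"

definition move_degree :: "int vec \<Rightarrow> int" where
  "move_degree u = (\<Sum>p<dim_vec u. pos_part u $ p)"

definition edge_list :: "nat \<Rightarrow> (nat \<times> nat) list" where
  "edge_list \<Delta> = [(i, j). i \<leftarrow> [1..<\<Delta> + 1], j \<leftarrow> [i..<\<Delta> + 1]]"

lemma set_edge_list: "set (edge_list \<Delta>) = {(i, j). 1 \<le> i \<and> i \<le> j \<and> j \<le> \<Delta>}"
  by (force simp: edge_list_def simp del: upt_Suc)

lemma length_edge_list: "length (edge_list \<Delta>) = (\<Delta> + 1) choose 2"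
proof -
  have "length (edge_list \<Delta>) = (\<Sum>i\<leftarrow>[1..<\<Delta> + 1]. \<Delta> + 1 - i)"
    by (simp add: edge_list_def length_concat comp_def del: upt_Suc)
  also have "\<dots> = (\<Sum>i=1..<\<Delta> + 1. \<Delta> + 1 - i)"
    by (simp add: interv_sum_list_conv_sum_set_nat del: upt_Suc)
  also have "\<dots> = (\<Sum>k=1..<\<Delta> + 1. k)"
    by (rule sum.reindex_bij_witness[of _ "\<lambda>k. \<Delta> + 1 - k" "\<lambda>k. \<Delta> + 1 - k"]) auto
  also have "\<dots> = (\<Delta> + 1) choose 2"
    by (induction \<Delta>) (simp_all add: numeral_2_eq_2)
  finally show ?thesis .
qed

text \<open>Rows and columns of \<^typ>\<open>int mat\<close> are counted from 0: row \<open>r < \<Delta>\<close> is the row of the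
  vertex \<open>a = r + 1\<close>, and row \<open>r \<ge> \<Delta>\<close> is the row of the sum \<open>\<kappa> = r + 2 - \<Delta>\<close>, which ranges over
  \<open>2, \<dots>, 2\<Delta>\<close>; column \<open>c\<close> belongs to the \<open>c\<close>-th pair of \<^const>\<open>edge_list\<close>.\<close>

definition B_mat :: "nat \<Rightarrow> int mat" where
  "B_mat \<Delta> = mat (3 * \<Delta> - 1) ((\<Delta> + 1) choose 2) (\<lambda>(r, c).
     let (i, j) = edge_list \<Delta> ! c in
     if r < \<Delta> then
       (let a = r + 1 in
        if i = a \<and> j = a then 2 else if (i = a) \<noteq> (j = a) then 1 else 0)
     else
       (let \<kappa> = r + 2 - \<Delta> in if i + j = \<kappa> then 1 else 0))"

end

(* With k = Delta div 2, write a move as an integer combination of differences of two pairs with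
   the same sum:
     F = (1,2k) - (2,2k-1),  T = (1,2k-1) - (k,k),  T' = (2,2k) - (k+1,k+1),
     D_p = (p-1,p+1) - (p,p)  for 2 <= p <= 2k-1, p different from k and k+1.
   The move is -(2k-3) F + T + T' + sum_p d_p D_p with d_p = 2(k-p) for p < k and d_p = 2(p-k-1)
   for p > k+1; its positive part has degree (2k-3) + 2 + 2(k-1)(k-2) = 2(k-1)^2 + 1.
   It is a circuit: a move supported on these pairs is an integer multiple of it, the multiple being
   the coefficient of T. Since that coefficient of the move itself is 1, no other nonzero move lies
   conformally below it. *)

theory Submission
  imports Defs
begin

section \<open>Vectors as functions on pairs, and the kernel as vertex and sum equations\<close>

definition edges :: "nat \<Rightarrow> (nat \<times> nat) set" where
  "edges \<Delta> = {(i, j). 1 \<le> i \<and> i \<le> j \<and> j \<le> \<Delta>}"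

definition edge_vec :: "nat \<Rightarrow> (nat \<times> nat \<Rightarrow> int) \<Rightarrow> int vec" where
  "edge_vec \<Delta> f = vec ((\<Delta> + 1) choose 2) (\<lambda>c. f (edge_list \<Delta> ! c))"

lemma distinct_edge_list: "distinct (edge_list \<Delta>)"
proof -
  \<comment> \<open>The outer list is generalised to any distinct \<open>xs\<close> so that list
    induction applies; blocks with different first components share no pair.\<close>
  have "distinct [(i, j). i \<leftarrow> xs, j \<leftarrow> [i..<m]]" if "distinct xs" for xs :: "nat list" and m
    using that by (induction xs) (auto simp: distinct_map inj_on_def)
  then show ?thesis by (simp add: edge_list_def del: upt_Suc)
qed

lemma bij_betw_edge_list:
  "bij_betw ((!) (edge_list \<Delta>)) {..<(\<Delta> + 1) choose 2} (edges \<Delta>)"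
  by (intro bij_betw_nth distinct_edge_list)
    (simp_all only: length_edge_list set_edge_list edges_def)

lemma finite_edges: "finite (edges \<Delta>)"
  using bij_betw_finite[OF bij_betw_edge_list] by blast

lemma sum_edge_list:
  "(\<Sum>c<(\<Delta> + 1) choose 2. f (edge_list \<Delta> ! c)) = (\<Sum>e\<in>edges \<Delta>. f e)"
  by (rule sum.reindex_bij_betw[OF bij_betw_edge_list])

lemma all_edge_list:
  "(\<forall>c<(\<Delta> + 1) choose 2. P (edge_list \<Delta> ! c)) \<longleftrightarrow> (\<forall>e\<in>edges \<Delta>. P e)"
  by (subst bij_betw_imp_surj_on[OF bij_betw_edge_list, symmetric]) blast

lemma edge_vec_exhaust:
  assumes "v \<in> carrier_vec ((\<Delta> + 1) choose 2)"
  obtains f where "v = edge_vec \<Delta> f"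
proof
  show "v = edge_vec \<Delta>
      (\<lambda>e. v $ inv_into {..<(\<Delta> + 1) choose 2} ((!) (edge_list \<Delta>)) e)"
    using assms bij_betw_imp_inj_on[OF bij_betw_edge_list[of \<Delta>]]
    by (intro eq_vecI) (simp_all add: edge_vec_def inv_into_f_f)
qed

lemma edge_vec_eq_iff: "edge_vec \<Delta> f = edge_vec \<Delta> g \<longleftrightarrow> (\<forall>e\<in>edges \<Delta>. f e = g e)"
  unfolding all_edge_list[symmetric] by (auto simp: edge_vec_def vec_eq_iff)

lemma edge_vec_zero: "edge_vec \<Delta> (\<lambda>_. 0) = 0\<^sub>v ((\<Delta> + 1) choose 2)"
  by (auto simp: edge_vec_def)

text \<open>Adding the indicators of both endpoints yields the entries 2, 1 and 0 of a vertex row by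
  one formula, a loop counting twice.\<close>

lemma B_mat_mult_edge_vec:
  assumes "r < 3 * \<Delta> - 1"
  shows "(B_mat \<Delta> *\<^sub>v edge_vec \<Delta> f) $ r =
    (if r < \<Delta> then \<Sum>(i, j)\<in>edges \<Delta>. f (i, j) * (of_bool (i = r + 1) + of_bool (j = r + 1))
     else \<Sum>(i, j)\<in>edges \<Delta>. f (i, j) * of_bool (i + j = r + 2 - \<Delta>))"
proof -
  have "(B_mat \<Delta> *\<^sub>v edge_vec \<Delta> f) $ r = (\<Sum>c<(\<Delta> + 1) choose 2.
      (\<lambda>(i, j). f (i, j) * (if r < \<Delta> then of_bool (i = r + 1) + of_bool (j = r + 1)
        else of_bool (i + j = r + 2 - \<Delta>))) (edge_list \<Delta> ! c))"
    using assms
    by (auto simp: B_mat_def edge_vec_def scalar_prod_def atLeast0LessThan Let_def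
        split: prod.splits intro!: sum.cong)
  also have "\<dots> = (\<Sum>(i, j)\<in>edges \<Delta>. f (i, j) *
      (if r < \<Delta> then of_bool (i = r + 1) + of_bool (j = r + 1)
       else of_bool (i + j = r + 2 - \<Delta>)))"
    by (rule sum_edge_list)
  finally show ?thesis by (simp split: if_splits)
qed

lemma edge_vec_in_kernel_iff:
  "edge_vec \<Delta> f \<in> mat_kernel (B_mat \<Delta>) \<longleftrightarrow>
    (\<forall>a\<in>{1..\<Delta>}. (\<Sum>(i, j)\<in>edges \<Delta>. f (i, j) * (of_bool (i = a) + of_bool (j = a))) = 0) \<and>
    (\<forall>\<kappa>\<in>{2..2 * \<Delta>}. (\<Sum>(i, j)\<in>edges \<Delta>. f (i, j) * of_bool (i + j = \<kappa>)) = 0)"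
    (is "_ \<longleftrightarrow> (\<forall>a\<in>_. ?V a = 0) \<and> (\<forall>\<kappa>\<in>_. ?S \<kappa> = 0)")
proof -
  have "edge_vec \<Delta> f \<in> mat_kernel (B_mat \<Delta>) \<longleftrightarrow>
      (\<forall>r<3 * \<Delta> - 1. (B_mat \<Delta> *\<^sub>v edge_vec \<Delta> f) $ r = 0)"
    by (auto simp: mat_kernel_def B_mat_def edge_vec_def vec_eq_iff)
  also have "\<dots> \<longleftrightarrow> (\<forall>r<3 * \<Delta> - 1. (if r < \<Delta> then ?V (r + 1) else ?S (r + 2 - \<Delta>)) = 0)"
    by (simp add: B_mat_mult_edge_vec)
  also have "\<dots> \<longleftrightarrow> (\<forall>a\<in>{1..\<Delta>}. ?V a = 0) \<and> (\<forall>\<kappa>\<in>{2..2 * \<Delta>}. ?S \<kappa> = 0)" (is "?L \<longleftrightarrow> ?R")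
  proof
    assume L: ?L
    have "?V a = 0" if "a \<in> {1..\<Delta>}" for a
    proof -
      have "a - 1 < 3 * \<Delta> - 1" "a - 1 < \<Delta>" "a - 1 + 1 = a" using that by auto
      then show ?thesis using L[rule_format, of "a - 1"] by simp
    qed
    moreover have "?S \<kappa> = 0" if "\<kappa> \<in> {2..2 * \<Delta>}" for \<kappa>
    proof -
      \<comment> \<open>The row of the sum \<kappa>, counted from 0; \<kappa> \<ge> 2 keeps the
        subtraction from truncating and puts the row after all vertex rows.\<close>
      have "\<kappa> + \<Delta> - 2 < 3 * \<Delta> - 1" "\<not> \<kappa> + \<Delta> - 2 < \<Delta>" "\<kappa> + \<Delta> - 2 + 2 - \<Delta> = \<kappa>"
        using that by auto
      then show ?thesis using L[rule_format, of "\<kappa> + \<Delta> - 2"] by simp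
    qed
    ultimately show ?R by blast
  next
    assume R: ?R
    have "r + 2 - \<Delta> \<in> {2..2 * \<Delta>}" if "r < 3 * \<Delta> - 1" "\<not> r < \<Delta>" for r
      using that by auto
    with R show ?L by simp
  qed
  finally show ?thesis .
qed

text \<open>This combines the vertex equations with weights \<open>h a\<close>: write
  \<open>h i\<close> as a sum of indicators and swap the sums. The free choice of \<open>h\<close>
  later isolates single coefficients.\<close>

lemma kernel_vertex_test:
  assumes "edge_vec \<Delta> f \<in> mat_kernel (B_mat \<Delta>)"
  shows "(\<Sum>(i, j)\<in>edges \<Delta>. f (i, j) * (h i + h j)) = 0"
proof -
  have "(\<Sum>(i, j)\<in>edges \<Delta>. f (i, j) * (h i + h j)) =
      (\<Sum>(i, j)\<in>edges \<Delta>. \<Sum>a\<in>{1..\<Delta>}. h a * (f (i, j) * (of_bool (i = a) + of_bool (j = a))))"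
  proof (intro sum.cong refl, clarify)
    fix i j assume "(i, j) \<in> edges \<Delta>"
    then have "i \<in> {1..\<Delta>}" "j \<in> {1..\<Delta>}" by (auto simp: edges_def)
    then have "(\<Sum>a\<in>{1..\<Delta>}. h a * of_bool (i = a)) = h i"
      "(\<Sum>a\<in>{1..\<Delta>}. h a * of_bool (j = a)) = h j"
      by (simp_all add: of_bool_def if_distrib[of "\<lambda>x. _ * x"] sum.delta' cong: if_cong)
    then have "f (i, j) * (h i + h j) = (\<Sum>a\<in>{1..\<Delta>}.
        f (i, j) * (h a * of_bool (i = a) + h a * of_bool (j = a)))"
      by (simp only: sum.distrib sum_distrib_left[symmetric])
    then show "f (i, j) * (h i + h j) =
        (\<Sum>a\<in>{1..\<Delta>}. h a * (f (i, j) * (of_bool (i = a) + of_bool (j = a))))"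
      by (simp only: distrib_left mult.left_commute)
  qed
  also have "\<dots> = (\<Sum>a\<in>{1..\<Delta>}. h a *
      (\<Sum>(i, j)\<in>edges \<Delta>. f (i, j) * (of_bool (i = a) + of_bool (j = a))))"
    unfolding sum_distrib_left case_prod_unfold by (rule sum.swap)
  also have "\<dots> = 0"
    using assms by (simp add: edge_vec_in_kernel_iff)
  finally show ?thesis .
qed

section \<open>The candidate move, its support and its coefficients\<close>

definition mids :: "nat \<Rightarrow> nat set" where
  "mids k = {2..2 * k - 1} - {k, k + 1}"

definition supp :: "nat \<Rightarrow> (nat \<times> nat) set" where
  "supp k = {(1, 2 * k), (2, 2 * k - 1), (1, 2 * k - 1), (k, k), (2, 2 * k), (k + 1, k + 1)} \<union>
     ((\<lambda>p. (p - 1, p + 1)) ` mids k \<union> (\<lambda>p. (p, p)) ` mids k)"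

definition coef :: "nat \<Rightarrow> nat \<Rightarrow> int" where
  "coef k p = (if p \<le> k then 2 * (int k - int p) else 2 * (int p - int k - 1))"

text \<open>The coefficient of \<open>D\<^sub>p\<close> is \<^term>\<open>coef k p\<close>; both branches vanish at the excluded
  positions \<open>p = k\<close> and \<open>p = k + 1\<close>, so sums over \<^term>\<open>mids k\<close> extend to the full interval.\<close>

definition wt :: "nat \<Rightarrow> nat \<times> nat \<Rightarrow> int" where
  "wt k = (\<lambda>(i, j).
     if (i, j) = (1, 2 * k) then 3 - 2 * int k
     else if (i, j) = (2, 2 * k - 1) then 2 * int k - 3
     else if (i, j) \<in> {(1, 2 * k - 1), (2, 2 * k)} then 1
     else if (i, j) \<in> {(k, k), (k + 1, k + 1)} then -1
     else if j = i + 2 \<and> i + 1 \<in> mids k then coef k (i + 1)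
     else if i = j \<and> i \<in> mids k then - coef k i
     else 0)"

lemma finite_mids [simp]: "finite (mids k)"
  by (simp add: mids_def)

text \<open>The difference \<open>j - i\<close> separates the pieces: it is 2 or 0 on the pairs from
  \<open>mids k\<close>, and 2k-1, 2k-3, 2k-2 or 0 on the corners. Loops are kept apart by the gap
  in \<open>mids k\<close>, and 2k-2 = 2 only for k = 2, when \<open>mids k\<close> is
  empty.\<close>

lemma sum_supp:
  fixes f :: "nat \<times> nat \<Rightarrow> 'a :: comm_monoid_add"
  assumes "k \<ge> 2"
  shows "(\<Sum>e\<in>supp k. f e) =
    f (1, 2 * k) + f (2, 2 * k - 1) + f (1, 2 * k - 1) + f (k, k) + f (2, 2 * k) + f (k + 1, k + 1)
    + (\<Sum>p\<in>mids k. f (p - 1, p + 1) + f (p, p))"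
proof -
  let ?C = "{(1, 2 * k), (2, 2 * k - 1), (1, 2 * k - 1), (k, k), (2, 2 * k), (k + 1, k + 1)}"
  have "(\<Sum>e\<in>supp k. f e) = (\<Sum>e\<in>?C. f e) +
      ((\<Sum>e\<in>(\<lambda>p. (p - 1, p + 1)) ` mids k. f e) + (\<Sum>e\<in>(\<lambda>p. (p, p)) ` mids k. f e))"
    unfolding supp_def using assms
    by (subst sum.union_disjoint; (subst sum.union_disjoint)?) (auto simp: mids_def)
  moreover have "(\<Sum>e\<in>(\<lambda>p. (p - 1, p + 1)) ` mids k. f e) = (\<Sum>p\<in>mids k. f (p - 1, p + 1))"
    by (subst sum.reindex) (auto simp: inj_on_def)
  moreover have "(\<Sum>e\<in>(\<lambda>p. (p, p)) ` mids k. f e) = (\<Sum>p\<in>mids k. f (p, p))"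
    by (subst sum.reindex) (auto simp: inj_on_def)
  moreover have "(\<Sum>e\<in>?C. f e) = f (1, 2 * k) + f (2, 2 * k - 1) + f (1, 2 * k - 1)
      + f (k, k) + f (2, 2 * k) + f (k + 1, k + 1)"
    using assms by (simp add: add.assoc)
  ultimately show ?thesis by (simp add: sum.distrib)
qed

lemma supp_subset_edges:
  assumes "k \<ge> 2" "2 * k \<le> \<Delta>"
  shows "supp k \<subseteq> edges \<Delta>"
  using assms by (auto simp: supp_def edges_def mids_def)

lemma wt_outside_supp:
  assumes "e \<notin> supp k"
  shows "wt k e = 0"
proof -
  obtain i j where e: "e = (i, j)" by force
  have "\<not> (j = i + 2 \<and> i + 1 \<in> mids k)"
    using assms unfolding e supp_def by (force intro: rev_image_eqI)
  moreover have "\<not> (i = j \<and> i \<in> mids k)"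
    using assms unfolding e supp_def by blast
  moreover have "(i, j) \<noteq> (1, 2 * k)" "(i, j) \<noteq> (2, 2 * k - 1)"
    "(i, j) \<notin> {(1, 2 * k - 1), (2, 2 * k)}" "(i, j) \<notin> {(k, k), (k + 1, k + 1)}"
    using assms unfolding e supp_def by blast+
  ultimately show ?thesis unfolding e wt_def prod.case by (simp only: if_False)
qed

lemma wt_simps:
  assumes "k \<ge> 2"
  shows "wt k (1, 2 * k) = 3 - 2 * int k" "wt k (2, 2 * k - 1) = 2 * int k - 3"
    "wt k (1, 2 * k - 1) = 1" "wt k (k, k) = -1" "wt k (2, 2 * k) = 1" "wt k (k + 1, k + 1) = -1"
    "p \<in> mids k \<Longrightarrow> wt k (p - 1, p + 1) = coef k p" "p \<in> mids k \<Longrightarrow> wt k (p, p) = - coef k p"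
  using assms by (auto simp: wt_def mids_def)

lemma sum_edges_supp:
  fixes f g :: "nat \<times> nat \<Rightarrow> int"
  assumes "k \<ge> 2" "2 * k \<le> \<Delta>" "\<And>e. e \<in> edges \<Delta> - supp k \<Longrightarrow> f e = 0"
  shows "(\<Sum>e\<in>edges \<Delta>. f e * g e) = (\<Sum>e\<in>supp k. f e * g e)"
  using assms supp_subset_edges[OF assms(1,2)] finite_edges
  by (intro sum.mono_neutral_right) auto

lemma sum_coef_mids:
  assumes "k \<ge> 2"
  shows "(\<Sum>p\<in>mids k. coef k p) = 2 * (int k - 1) * (int k - 2)"
proof -
  have "(\<Sum>p\<in>{2..2 * k - 1}. coef k p) = 2 * (int k - 1) * (int k - 2)" if "k \<ge> 1" for k
    using that
  proof (induction k rule: nat_induct_at_least)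
    case base
    then show ?case by simp
  next
    case (Suc k)
    \<comment> \<open>Shifting the index by one turns \<open>coef (Suc k)\<close> into
      \<open>coef k\<close>; the range then gains the ends 1 and 2k, each with coefficient
      2(k-1).\<close>
    have "(\<Sum>p\<in>{2..2 * Suc k - 1}. coef (Suc k) p) = (\<Sum>p\<in>{1..2 * k}. coef k p)"
      by (rule sum.reindex_bij_witness[of _ Suc "\<lambda>p. p - 1"]) (auto simp: coef_def)
    also have "{1..2 * k} = insert 1 (insert (2 * k) {2..2 * k - 1})"
      using Suc.hyps by auto
    also have "(\<Sum>p\<in>\<dots>. coef k p) = coef k 1 + coef k (2 * k) + (\<Sum>p\<in>{2..2 * k - 1}. coef k p)"
      using Suc.hyps by (subst sum.insert; (subst sum.insert)?) auto
    also have "\<dots> = 2 * (int (Suc k) - 1) * (int (Suc k) - 2)"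
      using Suc by (simp add: coef_def algebra_simps)
    finally show ?case .
  qed
  from this[of k] assms show ?thesis
    unfolding mids_def by (subst sum_diff) (auto simp: coef_def)
qed

section \<open>The kernel equations on the support: existence and uniqueness of the move\<close>

lemma wt_in_kernel:
  assumes k: "k \<ge> 2" "2 * k \<le> \<Delta>"
  shows "edge_vec \<Delta> (wt k) \<in> mat_kernel (B_mat \<Delta>)"
proof -
  \<comment> \<open>Pairing with an arbitrary \<open>g\<close> regroups the move into F, T, T' and
    the D_p, so each matrix row only needs its own \<open>g\<close>.\<close>
  have *: "(\<Sum>(i, j)\<in>edges \<Delta>. wt k (i, j) * g i j) =
      (2 * int k - 3) * (g 2 (2 * k - 1) - g 1 (2 * k)) + (g 1 (2 * k - 1) - g k k)
      + (g 2 (2 * k) - g (k + 1) (k + 1))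
      + (\<Sum>p\<in>{2..2 * k - 1}. coef k p * (g (p - 1) (p + 1) - g p p))" for g
  proof -
    have "(\<Sum>(i, j)\<in>edges \<Delta>. wt k (i, j) * g i j) =
      (\<Sum>e\<in>edges \<Delta>. wt k e * (case e of (i, j) \<Rightarrow> g i j))"
      by (simp add: case_prod_unfold)
    also have "\<dots> = (\<Sum>e\<in>supp k. wt k e * (case e of (i, j) \<Rightarrow> g i j))"
      by (rule sum_edges_supp[OF k]) (simp add: wt_outside_supp)
    also have "\<dots> = (2 * int k - 3) * (g 2 (2 * k - 1) - g 1 (2 * k)) + (g 1 (2 * k - 1) - g k k)
      + (g 2 (2 * k) - g (k + 1) (k + 1))
      + (\<Sum>p\<in>mids k. coef k p * (g (p - 1) (p + 1) - g p p))"
    proof -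
      have "(\<Sum>p\<in>mids k. wt k (p - 1, p + 1) * g (p - 1) (p + 1) + wt k (p, p) * g p p) =
          (\<Sum>p\<in>mids k. coef k p * (g (p - 1) (p + 1) - g p p))"
        by (intro sum.cong refl) (simp only: wt_simps[OF k(1)], simp add: algebra_simps)
      then show ?thesis
        unfolding sum_supp[OF k(1)] prod.case wt_simps(1-6)[OF k(1)] by (simp add: algebra_simps)
    qed
    also have "(\<Sum>p\<in>mids k. coef k p * (g (p - 1) (p + 1) - g p p)) =
      (\<Sum>p\<in>{2..2 * k - 1}. coef k p * (g (p - 1) (p + 1) - g p p))"
      by (rule sum.mono_neutral_left) (auto simp: mids_def coef_def)
    finally show ?thesis .
  qed
  \<comment> \<open>From the D_p, vertex \<open>a\<close> receives the second difference of
    \<open>coef k\<close> cut off outside 2..2k-1. It can be nonzero only at the kinks k, k+1 and at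
    the end vertices 1, 2, 2k-1, 2k, where F, T and T' cancel it.\<close>
  have "(\<Sum>(i, j)\<in>edges \<Delta>. wt k (i, j) * (of_bool (i = a) + of_bool (j = a))) = 0"
    if "a \<ge> 1" for a
  proof -
    have "(\<Sum>p\<in>{2..2 * k - 1}. coef k p * (of_bool (p - 1 = a) + of_bool (p + 1 = a)
        - (of_bool (p = a) + of_bool (p = a)))) =
      (\<Sum>p\<in>{2..2 * k - 1}. (if p = a + 1 then coef k p else 0) + (if p = a - 1 then coef k p else 0)
        - (if p = a then 2 * coef k p else 0))"
      using that by (intro sum.cong) auto
    also have "\<dots> = (if a + 1 \<in> {2..2 * k - 1} then coef k (a + 1) else 0)
        + (if a - 1 \<in> {2..2 * k - 1} then coef k (a - 1) else 0)
        - (if a \<in> {2..2 * k - 1} then 2 * coef k a else 0)"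
      by (simp only: sum.distrib sum_subtractf sum.delta finite_atLeastAtMost)
    finally show ?thesis
      unfolding * using that k(1) by (auto simp: coef_def of_bool_def split: if_splits)
  qed
  \<comment> \<open>Every bracket in \<open>*\<close> compares two pairs with the same sum.\<close>
  moreover have "(\<Sum>(i, j)\<in>edges \<Delta>. wt k (i, j) * of_bool (i + j = \<kappa>)) = 0" for \<kappa>
    unfolding * using k(1) by (auto simp: intro!: sum.neutral)
  ultimately show ?thesis by (auto simp: edge_vec_in_kernel_iff)
qed

text \<open>The sum rows leave one unknown for each of F, T, T' and D_p. Testing the vertex rows
  against ramps then expresses all of them through the coefficient of T.\<close>

lemma kernel_supported_on_supp:
  assumes k: "k \<ge> 2" "2 * k \<le> \<Delta>"
    and ker: "edge_vec \<Delta> f \<in> mat_kernel (B_mat \<Delta>)"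
    and f0: "\<And>e. e \<in> edges \<Delta> - supp k \<Longrightarrow> f e = 0"
    and e: "e \<in> edges \<Delta>"
  shows "f e = f (1, 2 * k - 1) * wt k e"
proof -
  have sum_eq: "(\<Sum>(i, j)\<in>edges \<Delta>. f (i, j) * g i j) =
      f (1, 2 * k) * g 1 (2 * k) + f (2, 2 * k - 1) * g 2 (2 * k - 1)
      + f (1, 2 * k - 1) * g 1 (2 * k - 1) + f (k, k) * g k k
      + f (2, 2 * k) * g 2 (2 * k) + f (k + 1, k + 1) * g (k + 1) (k + 1)
      + (\<Sum>p\<in>mids k. f (p - 1, p + 1) * g (p - 1) (p + 1) + f (p, p) * g p p)" for g
    using sum_edges_supp[OF k f0, where g = "\<lambda>(i, j). g i j"]
      sum_supp[OF k(1), of "\<lambda>(i, j). f (i, j) * g i j"]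
    by (simp add: case_prod_unfold)
  have fibre: "(\<Sum>(i, j)\<in>edges \<Delta>. f (i, j) * of_bool (i + j = \<kappa>)) = 0" if "\<kappa> \<in> {2..2 * \<Delta>}" for \<kappa>
    using ker that by (simp add: edge_vec_in_kernel_iff)
  \<comment> \<open>Facts \<open>1\<close> to \<open>4\<close> use the sums 2k+1, 2k, 2k+2 and 2p.
    Within the support each belongs to the two pairs of just one of F, T, T', D_p, so their entries
    are opposite. For 2k+1, parity excludes the loops and the D_p.\<close>
  have 1: "f (2, 2 * k - 1) = - f (1, 2 * k)"
  proof -
    have "(\<Sum>p\<in>mids k. f (p - 1, p + 1) * of_bool (p - 1 + (p + 1) = 2 * k + 1)
        + f (p, p) * of_bool (p + p = 2 * k + 1)) = 0"
    proof (intro sum.neutral ballI)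
      fix p assume "p \<in> mids k"
      then have "p - 1 + (p + 1) = 2 * p" by (auto simp: mids_def)
      moreover have "2 * p \<noteq> 2 * k + 1" "p + p \<noteq> 2 * k + 1" by presburger+
      ultimately show "f (p - 1, p + 1) * of_bool (p - 1 + (p + 1) = 2 * k + 1)
        + f (p, p) * of_bool (p + p = 2 * k + 1) = 0" by simp
    qed
    moreover have "k + k \<noteq> 2 * k + 1" "k + 1 + (k + 1) \<noteq> 2 * k + 1" by presburger+
    ultimately show ?thesis using fibre[of "2 * k + 1"] k unfolding sum_eq by simp
  qed
  have 2: "f (k, k) = - f (1, 2 * k - 1)"
  proof -
    have "(\<Sum>p\<in>mids k. f (p - 1, p + 1) * of_bool (p - 1 + (p + 1) = 2 * k)
        + f (p, p) * of_bool (p + p = 2 * k)) = 0"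
      by (intro sum.neutral) (auto simp: mids_def)
    then show ?thesis using fibre[of "2 * k"] k unfolding sum_eq by simp
  qed
  have 3: "f (k + 1, k + 1) = - f (2, 2 * k)"
  proof -
    have "(\<Sum>p\<in>mids k. f (p - 1, p + 1) * of_bool (p - 1 + (p + 1) = 2 * k + 2)
        + f (p, p) * of_bool (p + p = 2 * k + 2)) = 0"
      by (intro sum.neutral) (auto simp: mids_def)
    then show ?thesis using fibre[of "2 * k + 2"] k unfolding sum_eq by simp
  qed
  have 4: "f (p, p) = - f (p - 1, p + 1)" if p: "p \<in> mids k" for p
  proof -
    have "(\<Sum>q\<in>mids k. f (q - 1, q + 1) * of_bool (q - 1 + (q + 1) = 2 * p)
        + f (q, q) * of_bool (q + q = 2 * p)) =
      (\<Sum>q\<in>mids k. if q = p then f (q - 1, q + 1) + f (q, q) else 0)"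
      by (intro sum.cong) (auto simp: mids_def)
    also have "\<dots> = f (p - 1, p + 1) + f (p, p)"
      using p by (simp add: sum.delta)
    finally have "(\<Sum>q\<in>mids k. f (q - 1, q + 1) * of_bool (q - 1 + (q + 1) = 2 * p)
        + f (q, q) * of_bool (q + q = 2 * p)) = f (p - 1, p + 1) + f (p, p)" .
    moreover have "1 + 2 * k \<noteq> 2 * p" "2 + (2 * k - 1) \<noteq> 2 * p" "1 + (2 * k - 1) \<noteq> 2 * p"
      "k + k \<noteq> 2 * p" "2 + 2 * k \<noteq> 2 * p" "k + 1 + (k + 1) \<noteq> 2 * p" "2 * p \<in> {2..2 * \<Delta>}"
      using p k unfolding mids_def by (auto, presburger?)
    ultimately show ?thesis using fibre[of "2 * p"] unfolding sum_eq by simp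
  qed
  \<comment> \<open>Extending by 0 lets the ramp equation hold at k and k+1 as well, where there is
    no D_p.\<close>
  define x where "x p = (if p \<in> mids k then f (p - 1, p + 1) else 0)" for p
  have ramp: "f (1, 2 * k)
      + f (1, 2 * k - 1) * (if p \<le> k then int p - 1 else 2 * int k - 1 - int p)
      + f (2, 2 * k) * (if p \<le> k then int p - 2 else 2 * int k - int p) + x p = 0"
    if p: "2 \<le> p" "p \<le> 2 * k - 1" for p
  proof -
    \<comment> \<open>The second difference of \<open>h\<close> is the indicator of \<open>p\<close>, so testing against \<open>h\<close> isolates
      the coefficient of \<open>D\<^sub>p\<close>.\<close>
    define h where "h i = max 0 (int i - int p)" for i
    have "(\<Sum>q\<in>mids k. f (q - 1, q + 1) * (h (q - 1) + h (q + 1)) + f (q, q) * (h q + h q)) =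
      (\<Sum>q\<in>mids k. if q = p then f (q - 1, q + 1) else 0)"
      by (intro sum.cong) (auto simp: 4 h_def mids_def max_def algebra_simps of_nat_diff)
    also have "\<dots> = x p"
      by (simp add: sum.delta x_def)
    finally have "(\<Sum>q\<in>mids k. f (q - 1, q + 1) * (h (q - 1) + h (q + 1))
        + f (q, q) * (h q + h q)) = x p" .
    with kernel_vertex_test[OF ker, of h] have
      "f (1, 2 * k) * (h 1 + h (2 * k) - h 2 - h (2 * k - 1))
      + f (1, 2 * k - 1) * (h 1 + h (2 * k - 1) - 2 * h k)
      + f (2, 2 * k) * (h 2 + h (2 * k) - 2 * h (k + 1)) + x p = 0"
      unfolding sum_eq 1 2 3 by (simp add: algebra_simps)
    moreover have "h 1 + h (2 * k) - h 2 - h (2 * k - 1) = 1"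
      "h 1 + h (2 * k - 1) - 2 * h k = (if p \<le> k then int p - 1 else 2 * int k - 1 - int p)"
      "h 2 + h (2 * k) - 2 * h (k + 1) = (if p \<le> k then int p - 2 else 2 * int k - int p)"
      using p k by (auto simp: h_def max_def of_nat_diff)
    ultimately show ?thesis by simp
  qed
  \<comment> \<open>The gap in \<open>mids k\<close> supplies the two decisive equations.
    Subtracting the ramp equation at k+1 from that at k equates the coefficients of T and T';
    substituting back gives that of F.\<close>
  have "x k = 0" "x (k + 1) = 0" by (simp_all add: x_def mids_def)
  with ramp[of k] ramp[of "k + 1"] k
  have 5: "f (2, 2 * k) = f (1, 2 * k - 1)" and 6: "f (1, 2 * k) = (3 - 2 * int k) * f (1, 2 * k - 1)"
    by (simp_all add: algebra_simps)
  have 7: "f (p - 1, p + 1) = f (1, 2 * k - 1) * coef k p" if p: "p \<in> mids k" for p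
    using ramp[of p] p unfolding 5 6
    by (auto simp: mids_def x_def coef_def algebra_simps split: if_splits)
  show ?thesis
  proof (cases "e \<in> supp k")
    case True
    then consider (corner) "e \<in> {(1, 2 * k), (2, 2 * k - 1), (1, 2 * k - 1), (k, k), (2, 2 * k),
        (k + 1, k + 1)}"
      | (mid) p where "p \<in> mids k" "e = (p - 1, p + 1) \<or> e = (p, p)"
      unfolding supp_def by blast
    then show ?thesis
    proof cases
      case corner
      then show ?thesis
        by (elim insertE emptyE; hypsubst; simp only: 1 2 3 5 6 wt_simps(1-6)[OF k(1)];
            simp add: algebra_simps)
    next
      case mid
      note p = \<open>p \<in> mids k\<close>
      from mid(2) show ?thesis
        by (elim disjE; hypsubst; simp only: 4[OF p] 7[OF p] wt_simps(7,8)[OF k(1) p]; simp)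
    qed
  next
    case False
    then show ?thesis using e f0 by (simp add: wt_outside_supp)
  qed
qed

section \<open>Conformality, primitivity and degree\<close>

lemma conformal_edge_vec:
  assumes "pos_part (edge_vec \<Delta> g) - pos_part (edge_vec \<Delta> f) \<ge> 0\<^sub>v ((\<Delta> + 1) choose 2)"
    and "neg_part (edge_vec \<Delta> g) - neg_part (edge_vec \<Delta> f) \<ge> 0\<^sub>v ((\<Delta> + 1) choose 2)"
    and "e \<in> edges \<Delta>"
  shows "max (f e) 0 \<le> max (g e) 0" "max (- f e) 0 \<le> max (- g e) 0"
proof -
  have "\<forall>e\<in>edges \<Delta>. max (f e) 0 \<le> max (g e) 0 \<and> max (- f e) 0 \<le> max (- g e) 0"
    unfolding all_edge_list[symmetric]
  proof (intro allI impI)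
    fix c assume c: "c < (\<Delta> + 1) choose 2"
    let ?e = "edge_list \<Delta> ! c"
    have "max (f ?e) 0 \<le> max (g ?e) 0" "max (f ?e) 0 - f ?e \<le> max (g ?e) 0 - g ?e"
      using assms(1,2) c by (auto simp: less_eq_vec_def pos_part_def neg_part_def edge_vec_def)
    then show "max (f ?e) 0 \<le> max (g ?e) 0 \<and> max (- f ?e) 0 \<le> max (- g ?e) 0"
      by linarith
  qed
  with assms(3) show "max (f e) 0 \<le> max (g e) 0" "max (- f e) 0 \<le> max (- g e) 0" by blast+
qed

lemma primitive_wt:
  assumes k: "k \<ge> 2" "2 * k \<le> \<Delta>"
  shows "primitive_move (B_mat \<Delta>) (edge_vec \<Delta> (wt k))"
proof -
  have dim: "dim_col (B_mat \<Delta>) = (\<Delta> + 1) choose 2" by (simp add: B_mat_def)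
  have e1: "(1, 2 * k - 1) \<in> edges \<Delta>" using k by (auto simp: edges_def)
  have "edge_vec \<Delta> (wt k) \<noteq> 0\<^sub>v ((\<Delta> + 1) choose 2)"
    unfolding edge_vec_zero[symmetric] edge_vec_eq_iff using e1 wt_simps(3)[OF k(1)] by force
  moreover have "v = 0\<^sub>v ((\<Delta> + 1) choose 2) \<or> v = edge_vec \<Delta> (wt k)"
    if ker: "v \<in> mat_kernel (B_mat \<Delta>)"
      and le: "pos_part (edge_vec \<Delta> (wt k)) - pos_part v \<ge> 0\<^sub>v ((\<Delta> + 1) choose 2)"
        "neg_part (edge_vec \<Delta> (wt k)) - neg_part v \<ge> 0\<^sub>v ((\<Delta> + 1) choose 2)" for v
  proof -
    have "v \<in> carrier_vec ((\<Delta> + 1) choose 2)"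
      using ker dim by (simp add: mat_kernel_def)
    then obtain f where v: "v = edge_vec \<Delta> f" by (rule edge_vec_exhaust)
    note conf = conformal_edge_vec[OF le[unfolded v]]
    \<comment> \<open>Where \<open>wt k\<close> vanishes, conformality bounds both signed parts of
      \<open>f\<close> by 0, so \<open>f\<close> is supported on \<open>supp k\<close>.\<close>
    have "f e = 0" if "e \<in> edges \<Delta> - supp k" for e
      using conf[of e] that by (simp add: wt_outside_supp)
    then have f: "f e = f (1, 2 * k - 1) * wt k e" if "e \<in> edges \<Delta>" for e
      using kernel_supported_on_supp[OF k ker[unfolded v] _ that] by blast
    \<comment> \<open>The entry of \<open>wt k\<close> here is 1, so conformality confines the
      integer multiplier to 0 or 1.\<close>
    have "f (1, 2 * k - 1) = 0 \<or> f (1, 2 * k - 1) = 1"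
      using conf[OF e1] wt_simps(3)[OF k(1)] by linarith
    then show ?thesis
      unfolding v edge_vec_zero[symmetric] edge_vec_eq_iff using f by fastforce
  qed
  ultimately show ?thesis
    unfolding primitive_move_def dim using wt_in_kernel[OF k] by blast
qed

lemma move_degree_wt:
  assumes k: "k \<ge> 2" "2 * k \<le> \<Delta>"
  shows "move_degree (edge_vec \<Delta> (wt k)) = 2 * (int k - 1)\<^sup>2 + 1"
proof -
  have "move_degree (edge_vec \<Delta> (wt k)) = (\<Sum>e\<in>edges \<Delta>. max (wt k e) 0 * 1)"
    unfolding sum_edge_list[symmetric] by (simp add: move_degree_def pos_part_def edge_vec_def)
  also have "\<dots> = (\<Sum>e\<in>supp k. max (wt k e) 0 * 1)"
    by (rule sum_edges_supp[OF k]) (simp add: wt_outside_supp)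
  \<comment> \<open>The positive corners are (2, 2k-1), (1, 2k-1) and (2, 2k).\<close>
  also have "\<dots> = (2 * int k - 3) + 1 + 1
      + (\<Sum>p\<in>mids k. max (wt k (p - 1, p + 1)) 0 + max (wt k (p, p)) 0)"
    unfolding mult_1_right sum_supp[OF k(1)] wt_simps(1-6)[OF k(1)] using k by simp
  also have "(\<Sum>p\<in>mids k. max (wt k (p - 1, p + 1)) 0 + max (wt k (p, p)) 0) =
      (\<Sum>p\<in>mids k. coef k p)"
  proof (intro sum.cong refl)
    fix p assume "p \<in> mids k"
    moreover from this have "coef k p \<ge> 0" by (auto simp: coef_def)
    ultimately show "max (wt k (p - 1, p + 1)) 0 + max (wt k (p, p)) 0 = coef k p"
      by (simp only: wt_simps(7,8)[OF k(1)])
  qed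
  finally show ?thesis
    unfolding sum_coef_mids[OF k(1)] by (simp add: algebra_simps power2_eq_square)
qed

theorem theorem3p5:
  fixes \<Delta> :: nat
  assumes "\<Delta> \<ge> 4"
  shows "\<exists>u :: int vec. primitive_move (B_mat \<Delta>) u \<and>
           move_degree u = 2 * (\<lfloor>real \<Delta> / 2\<rfloor> - 1)\<^sup>2 + 1"
proof -
  \<comment> \<open>Take k = \<Delta> div 2; for odd \<Delta> the move simply avoids the vertex
    \<Delta>.\<close>
  have "\<Delta> div 2 \<ge> 2" "2 * (\<Delta> div 2) \<le> \<Delta>" using assms by auto
  moreover have "\<lfloor>real \<Delta> / 2\<rfloor> = int (\<Delta> div 2)" by linarith
  ultimately show ?thesis using primitive_wt move_degree_wt by metis
qed

end
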